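(* For topological spaces, the following implications hold: $$T_2\Rightarrow k_1H\Rightarrow KC\Rightarrow wH\Rightarrow k_2H\Rightarrow US\Rightarrow T_1,$$ and none of these implications reverses. That is: every $T_2$ space is $k_1H$; every $k_1H$ space is $KC$; every $KC$ space is $wH$; every $wH$ space is $k_2H$; every $k_2H$ space is $US$; every $US$ space is $T_1$; and moreover there exist a $k_1H$ space that is not $T_2$, a $KC$ space that is not $k_1H$, a $wH$ space that is not $KC$, a $k_2H$ space that is not $wH$, a $US$ space that is not $k_2H$, and a $T_1$ space that is not $US$.
   Context: "Compact" means every open cover has a finite subcover (no separation axiom assumed). Let $X$ be a topological space. $X$ is $k_1H$ ($k_1$-Hausdorff) if every compact subspace of $X$ is $T_2$ (Hausdorff). $X$ is $KC$ if every compact subset of $X$ is closed in $X$. $X$ is $wH$ (weakly Hausdorff) if for every compact Hausdorff space $K$ and every continuous map $f:K\to X$, the image $f[K]$ is closed in $X$. A subset $C$ of a space $Y$ is $k_2$-closed if for every compact Hausdorff space $K$ and every continuous map $f:K\to Y$, the preimage $f^{-1}[C]$ is closed in $K$. $X$ is $k_2H$ ($k_2$-Hausdorff) if the diagonal $\Delta_X=\{(x,x):x\in X\}$ is $k_2$-closed in $X^2$ with the product topology. $X$ is $US$ if every convergent sequence in $X$ has a unique limit. *)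

theory Defs
  imports "HOL-Analysis.Analysis"
begin

definition k1_Hausdorff_space :: "'a topology \<Rightarrow> bool" where
  "k1_Hausdorff_space X \<longleftrightarrow> (\<forall>S. compactin X S \<longrightarrow> Hausdorff_space (subtopology X S))"

definition US_space :: "'a topology \<Rightarrow> bool" where
  "US_space X \<longleftrightarrow>
     (\<forall>(s :: nat \<Rightarrow> 'a) l m. range s \<subseteq> topspace X \<and> limitin X s l sequentially \<and>
        limitin X s m sequentially \<longrightarrow> l = m)"

text \<open>
  HOL cannot quantify over the types carrying the test spaces \<open>K\<close> inside a definition. Every
  test space that matters for a space with points in \<open>'a\<close> can be replaced by one with points in
  \<open>'a test_point\<close>: the lemmas \<open>weakly_Hausdorff_spaceD\<close> and
  \<open>k2_Hausdorff_spaceD\<close> below show that the definitions made with this type imply the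
  conditions for compact Hausdorff spaces \<open>K\<close> on an arbitrary type. The summand
  \<^typ>\<open>nat\<close> provides infinite test spaces when \<open>'a\<close> is finite.
\<close>

type_synonym 'a test_point = "(nat + 'a) set set"

definition weakly_Hausdorff_space :: "'a topology \<Rightarrow> bool" where
  "weakly_Hausdorff_space X \<longleftrightarrow>
     (\<forall>(K :: 'a test_point topology) f.
        compact_space K \<and> Hausdorff_space K \<and> continuous_map K X f \<longrightarrow>
        closedin X (f ` topspace K))"

text \<open>The argument \<open>k\<close> only fixes the type of the points of the test spaces.\<close>

definition k2_closedin :: "'k itself \<Rightarrow> 'a topology \<Rightarrow> 'a set \<Rightarrow> bool" where
  "k2_closedin k Y C \<longleftrightarrow>
     C \<subseteq> topspace Y \<and>
     (\<forall>(K :: 'k topology) f.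
        compact_space K \<and> Hausdorff_space K \<and> continuous_map K Y f \<longrightarrow>
        closedin K {x \<in> topspace K. f x \<in> C})"

definition k2_Hausdorff_space :: "'a topology \<Rightarrow> bool" where
  "k2_Hausdorff_space X \<longleftrightarrow>
     k2_closedin TYPE('a test_point) (prod_topology X X) {(x, x) |x. x \<in> topspace X}"


subsection \<open>Independence of the type of the test spaces\<close>

lemma transport_topology:
  fixes K :: "'k topology" and e :: "'k \<Rightarrow> 'u"
  assumes "inj_on e (topspace K)"
  obtains K' where "homeomorphic_map K K' e"
proof -
  let ?op = "\<lambda>S. S \<subseteq> e ` topspace K \<and> openin K {x \<in> topspace K. e x \<in> S}"
  have "istopology ?op"
    unfolding istopology_def
  proof (intro conjI allI impI)
    fix S T assume "?op S" "?op T"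
    moreover have "{x \<in> topspace K. e x \<in> S \<inter> T} =
        {x \<in> topspace K. e x \<in> S} \<inter> {x \<in> topspace K. e x \<in> T}" by auto
    ultimately show "openin K {x \<in> topspace K. e x \<in> S \<inter> T}" by auto
  next
    fix \<K> assume "\<forall>S\<in>\<K>. ?op S"
    moreover have "{x \<in> topspace K. e x \<in> \<Union>\<K>} = (\<Union>S\<in>\<K>. {x \<in> topspace K. e x \<in> S})" by auto
    ultimately show "openin K {x \<in> topspace K. e x \<in> \<Union>\<K>}" by auto
  qed auto
  then have op: "openin (topology ?op) S \<longleftrightarrow> ?op S" for S by simp
  have "{x \<in> topspace K. e x \<in> e ` topspace K} = topspace K" by auto
  then have "openin (topology ?op) (e ` topspace K)" by (simp add: op)
  then have top: "topspace (topology ?op) = e ` topspace K"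
    using op[of "topspace (topology ?op)"] openin_topspace openin_subset
    by (intro subset_antisym) blast+
  have "quotient_map K (topology ?op) e"
    unfolding quotient_map_def top op by simp
  then have "homeomorphic_map K (topology ?op) e"
    using assms by (simp add: homeomorphic_map_def)
  then show thesis by (rule that)
qed

lemma weakly_Hausdorff_spaceD:
  fixes X :: "'a topology" and K :: "'k topology"
  assumes X: "weakly_Hausdorff_space X"
    and K: "compact_space K" "Hausdorff_space K" and f: "continuous_map K X f"
  shows "closedin X (f ` topspace K)"
proof -
  define s where "s = inv_into (topspace K) f"
  define B where "B = f ` topspace K"
  have fs: "f (s b) = b" if "b \<in> B" for b
    using that unfolding s_def B_def by (rule f_inv_into_f)
  have sub: "s ` B \<subseteq> topspace K" unfolding s_def B_def by (auto intro: inv_into_into)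
  define D where "D = K closure_of (s ` B)"
  define L where "L = subtopology K D"
  have Dsub: "D \<subseteq> topspace K" unfolding D_def by (rule closure_of_subset_topspace)
  have topL: "topspace L = D" using Dsub by (auto simp: L_def)
  have sD: "s ` B \<subseteq> D" unfolding D_def using sub by (rule closure_of_subset)
  have L: "compact_space L" "Hausdorff_space L" "continuous_map L X f"
    using K f unfolding L_def D_def
    by (auto intro!: compact_space_subtopology closedin_compact_space Hausdorff_space_subtopology
        continuous_map_from_subtopology)
  have im: "f ` D = B"
  proof
    show "f ` D \<subseteq> B" using Dsub by (auto simp: B_def)
    show "B \<subseteq> f ` D" using sD fs by force
  qed
  define e :: "'k \<Rightarrow> 'a test_point"
    where "e x = {Inr ` A | A. A \<subseteq> B \<and> x \<in> K closure_of (s ` A)}" for x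
  have "inj_on e D"
  proof (rule inj_onI, rule ccontr)
    fix x y assume xy: "x \<in> D" "y \<in> D" "e x = e y" "x \<noteq> y"
    then have "x \<in> topspace K" "y \<in> topspace K" using Dsub by auto
    then obtain U V where UV: "openin K U" "openin K V" "x \<in> U" "y \<in> V" "disjnt U V"
      using K(2) xy(4) unfolding Hausdorff_space_def by blast
    define A where "A = {b \<in> B. s b \<in> U}"
    have sA: "s ` A = U \<inter> s ` B" by (auto simp: A_def)
    have "x \<in> K closure_of (s ` A)"
      unfolding sA using UV(1,3) xy(1) unfolding D_def
      by (meson IntI openin_Int_closure_of_subset subsetD)
    then have "Inr ` A \<in> e x" by (auto simp: e_def A_def)
    then have "Inr ` A \<in> e y" using xy(3) by simp
    then have "y \<in> K closure_of (s ` A)"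
      by (auto simp: e_def inj_image_eq_iff)
    then have "V \<inter> s ` A \<noteq> {}"
      using UV(2,4) by (auto simp: in_closure_of)
    then show False using UV(5) by (auto simp: sA disjnt_def)
  qed
  then obtain K' where K': "homeomorphic_map L K' e"
    using transport_topology[of e L] by (auto simp: topL)
  then obtain g where g: "homeomorphic_maps L K' e g"
    by (auto simp: homeomorphic_map_maps)
  then have "L homeomorphic_space K'" by (auto simp: homeomorphic_space_def)
  then have "compact_space K'" "Hausdorff_space K'"
    using L homeomorphic_compact_space homeomorphic_Hausdorff_space by blast+
  moreover have "continuous_map K' X (f \<circ> g)"
    using g L(3) by (auto simp: homeomorphic_maps_def intro: continuous_map_compose)
  ultimately have "closedin X ((f \<circ> g) ` topspace K')"
    using X unfolding weakly_Hausdorff_space_def by blast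
  moreover have "g ` topspace K' = D"
    using g homeomorphic_maps_sym[of L K' e g] homeomorphic_maps_map[of K' L g e]
      homeomorphic_imp_surjective_map[of K' L g] topL by auto
  ultimately show ?thesis using im unfolding B_def by (metis image_comp)
qed

lemma k2_closedin_transport:
  fixes K :: "'k topology" and e :: "'k \<Rightarrow> 'u"
  assumes C: "k2_closedin TYPE('u) Y C"
    and K: "compact_space K" "Hausdorff_space K" and f: "continuous_map K Y f"
    and e: "inj_on e (topspace K)"
  shows "closedin K {x \<in> topspace K. f x \<in> C}"
proof -
  obtain K' where K': "homeomorphic_map K K' e"
    using e by (rule transport_topology)
  then obtain g where g: "homeomorphic_maps K K' e g"
    by (auto simp: homeomorphic_map_maps)
  then have "K homeomorphic_space K'" by (auto simp: homeomorphic_space_def)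
  then have "compact_space K'" "Hausdorff_space K'"
    using K homeomorphic_compact_space homeomorphic_Hausdorff_space by blast+
  moreover have "continuous_map K' Y (f \<circ> g)"
    using g f by (auto simp: homeomorphic_maps_def intro: continuous_map_compose)
  ultimately have "closedin K' {x \<in> topspace K'. (f \<circ> g) x \<in> C}"
    using C unfolding k2_closedin_def by blast
  then have "closedin K {x \<in> topspace K. e x \<in> {x \<in> topspace K'. (f \<circ> g) x \<in> C}}"
    using g by (intro closedin_continuous_map_preimage[of K K']) (auto simp: homeomorphic_maps_def)
  moreover have "{x \<in> topspace K. e x \<in> {x \<in> topspace K'. (f \<circ> g) x \<in> C}} =
      {x \<in> topspace K. f x \<in> C}"
    using g by (auto simp: homeomorphic_maps_def continuous_map_def Pi_iff)
  ultimately show ?thesis by simp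
qed

lemma inj_real_code:
  fixes h :: "nat \<Rightarrow> 'i \<Rightarrow> 'c"
  assumes "inj (case_prod h)"
  shows "inj (\<lambda>F :: 'i \<Rightarrow> real. {h n i | n i. F i < real_of_rat (nat_to_rat_surj n)})"
proof (rule injI, rule ext, rule ccontr)
  fix F G :: "'i \<Rightarrow> real" and i
  assume eq: "{h n i | n i. F i < real_of_rat (nat_to_rat_surj n)} =
    {h n i | n i. G i < real_of_rat (nat_to_rat_surj n)}" and ne: "F i \<noteq> G i"
  have inj: "n = m \<and> i = j" if "h n i = h m j" for n m i j
    using assms that by (auto dest: injD[where x="(n, i)" and y="(m, j)"])
  have iff: "F i < real_of_rat (nat_to_rat_surj n) \<longleftrightarrow> G i < real_of_rat (nat_to_rat_surj n)" for n
  proof -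
    have "h n i \<in> {h n i | n i. F i < real_of_rat (nat_to_rat_surj n)} \<longleftrightarrow>
      h n i \<in> {h n i | n i. G i < real_of_rat (nat_to_rat_surj n)}" using eq by simp
    then show ?thesis using inj by blast
  qed
  have all: "F i < real_of_rat q \<longleftrightarrow> G i < real_of_rat q" for q
    using iff surj_nat_to_rat_surj by (metis surjD)
  show False
  proof (cases "F i < G i")
    case True
    then obtain q where "F i < real_of_rat q" "real_of_rat q < G i" using of_rat_dense by blast
    then show False using all[of q] by simp
  next
    case False
    then obtain q where "G i < real_of_rat q" "real_of_rat q < F i"
      using ne of_rat_dense by (metis linorder_neqE_linordered_idom)
    then show False using all[of q] by simp
  qed
qed

definition index_code :: "nat \<Rightarrow> bool \<times> 'a set \<Rightarrow> (nat + 'a) set" where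
  "index_code n i = insert (Inl (2 * n + of_bool (fst i))) (Inr ` snd i)"

lemma inj_index_code: "inj (case_prod index_code)"
proof (rule injI, clarify)
  fix n m :: nat and b c :: bool and S T :: "'a set"
  assume "index_code n (b, S) = index_code m (c, T)"
  then have eq: "Inl x \<in> index_code n (b, S) \<longleftrightarrow> Inl x \<in> index_code m (c, T)"
    "Inr y \<in> index_code n (b, S) \<longleftrightarrow> Inr y \<in> index_code m (c, T)" for x y by simp_all
  have "2 * n + of_bool b = 2 * m + (of_bool c :: nat)"
    using eq(1)[of "2 * n + of_bool b"] by (auto simp: index_code_def)
  moreover have "S = T" using eq(2) by (auto simp: index_code_def)
  ultimately show "n = m \<and> (b, S) = (c, T)"
    by (cases b; cases c; simp; presburger)
qed

lemma k2_Hausdorff_imp_t1_space: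
  fixes X :: "'a topology"
  assumes "k2_Hausdorff_space X"
  shows "t1_space X"
  unfolding t1_space_def
proof (intro ballI impI, rule ccontr)
  fix x y assume xy: "x \<in> topspace X" "y \<in> topspace X" "x \<noteq> y"
    and "\<not> (\<exists>U. openin X U \<and> x \<in> U \<and> y \<notin> U)"
  then have nb: "y \<in> U" if "openin X U" "x \<in> U" for U using that by blast
  let ?D = "{(x, x) |x. x \<in> topspace X}"
  define K where "K = top_of_set {0..1::real}"
  define f where "f t = (if t = 0 then (x, y) else (y, y))" for t :: real
  have K: "compact_space K" "Hausdorff_space K"
    unfolding K_def by (auto simp: compact_space_subtopology Hausdorff_space_subtopology)
  have f: "continuous_map K (prod_topology X X) f"
    unfolding continuous_map_def
  proof (intro conjI allI impI)
    show "f \<in> topspace K \<rightarrow> topspace (prod_topology X X)"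
      using xy by (auto simp: f_def)
    fix W assume W: "openin (prod_topology X X) W"
    have yy: "(y, y) \<in> W" if xyW: "(x, y) \<in> W"
    proof -
      obtain U V where "openin X U" "openin X V" "x \<in> U" "y \<in> V" "U \<times> V \<subseteq> W"
        using openin_prod_topology_alt[THEN iffD1, OF W, rule_format, OF xyW] by metis
      then show ?thesis using nb by blast
    qed
    consider "(x, y) \<in> W" | "(x, y) \<notin> W" "(y, y) \<in> W" | "(x, y) \<notin> W" "(y, y) \<notin> W" by blast
    then show "openin K {t \<in> topspace K. f t \<in> W}"
    proof cases
      case 1
      then have "{t \<in> topspace K. f t \<in> W} = topspace K" using yy by (auto simp: f_def)
      then show ?thesis by simp
    next
      case 2
      then have "{t \<in> topspace K. f t \<in> W} = topspace K \<inter> (- {0})" by (auto simp: f_def)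
      then show ?thesis unfolding K_def by (simp add: openin_open_Int open_Compl)
    next
      case 3
      then have "{t \<in> topspace K. f t \<in> W} = {}" by (auto simp: f_def)
      then show ?thesis by (simp only: openin_empty)
    qed
  qed
  let ?c = "\<lambda>F :: unit \<Rightarrow> real. {{Inl n :: nat + 'a} | n i. F i < real_of_rat (nat_to_rat_surj n)}"
  have "inj ?c" by (rule inj_real_code) (auto intro!: injI)
  moreover have "inj (\<lambda>(r :: real) (_ :: unit). r)" by (auto intro!: injI dest: fun_cong)
  ultimately have "inj (?c \<circ> (\<lambda>r _. r))" by (rule inj_compose)
  then have "closedin K {t \<in> topspace K. f t \<in> ?D}"
    using k2_closedin_transport[OF assms[unfolded k2_Hausdorff_space_def] K f]
    by (blast intro: inj_on_subset)
  moreover have "{t \<in> topspace K. f t \<in> ?D} = {0<..1}"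
    using xy by (auto simp: f_def K_def)
  ultimately have "closed {0<..1::real}"
    by (simp only: K_def closedin_closed_eq[OF closed_atLeastAtMost])
  then have "closure {0<..1::real} = {0<..1}" by (rule closure_closed)
  then have "{0..1::real} = {0<..1}" by simp
  then show False by (metis atLeastAtMost_iff greaterThanAtMost_iff less_irrefl order_refl zero_le_one)
qed

lemma k2_Hausdorff_spaceD:
  fixes X :: "'a topology"
  assumes X: "k2_Hausdorff_space X"
  shows "k2_closedin TYPE('k) (prod_topology X X) {(x, x) |x. x \<in> topspace X}"
  unfolding k2_closedin_def
proof (intro conjI allI impI)
  let ?D = "{(x, x) |x. x \<in> topspace X}"
  show "?D \<subseteq> topspace (prod_topology X X)" by auto
  fix K :: "'k topology" and f
  assume asm: "compact_space K \<and> Hausdorff_space K \<and> continuous_map K (prod_topology X X) f"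
  then have K: "compact_space K" "Hausdorff_space K"
    and f: "continuous_map K (prod_topology X X) f" by auto
  define p where "p b = (if b then fst \<circ> f else snd \<circ> f)" for b :: bool
  have p: "continuous_map K X (p b)" for b
    using f unfolding p_def continuous_map_pairwise by auto
  have normal: "normal_space K"
    using K compact_Hausdorff_or_regular_imp_normal_space by blast
  have ex: "\<exists>g. continuous_map K euclideanreal g \<and>
      (\<forall>x\<in>topspace K. \<forall>y\<in>topspace K. S = {p b x, p b y} \<and> p b x \<noteq> p b y \<longrightarrow> g x \<noteq> g y)"
    for b and S :: "'a set"
  proof (cases "\<exists>a c. a \<in> topspace X \<and> c \<in> topspace X \<and> a \<noteq> c \<and> S = {a, c}")
    case True
    then obtain a c where ac: "a \<in> topspace X" "c \<in> topspace X" "a \<noteq> c" "S = {a, c}" by blast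
    let ?A = "\<lambda>a. {x \<in> topspace K. p b x \<in> {a}}"
    have "closedin K (?A a)" "closedin K (?A c)"
      using k2_Hausdorff_imp_t1_space[OF X] ac(1,2)
      by (intro closedin_continuous_map_preimage[OF p]; simp add: t1_space_closedin_singleton)+
    moreover have "disjnt (?A a) (?A c)" using ac by (auto simp: disjnt_def)
    ultimately obtain g where g: "continuous_map K (top_of_set {0..1::real}) g"
      "g ` ?A a \<subseteq> {0}" "g ` ?A c \<subseteq> {1}"
      using Urysohn_lemma[OF normal, of "?A a" "?A c" 0 1] by auto
    have "g x \<noteq> g y" if "x \<in> topspace K" "y \<in> topspace K" "S = {p b x, p b y}" for x y
    proof -
      have "p b x = a \<and> p b y = c \<or> p b x = c \<and> p b y = a"
        using that(3) ac(3,4) by (auto simp: doubleton_eq_iff)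
      then show ?thesis using that(1,2) g(2,3) by (auto simp: image_subset_iff)
    qed
    then show ?thesis using g(1) by (auto simp: continuous_map_in_subtopology)
  next
    case False
    then have "\<not> (S = {p b x, p b y} \<and> p b x \<noteq> p b y)"
      if "x \<in> topspace K" "y \<in> topspace K" for x y
      using p[of b] that by (auto simp: continuous_map_def Pi_iff)
    then show ?thesis by (intro exI[of _ "\<lambda>_. 0"]) auto
  qed
  define g where "g b S = (SOME g. continuous_map K euclideanreal g \<and>
      (\<forall>x\<in>topspace K. \<forall>y\<in>topspace K. S = {p b x, p b y} \<and> p b x \<noteq> p b y \<longrightarrow> g x \<noteq> g y))"
    for b S
  have g: "continuous_map K euclideanreal (g b S)"
    and sep: "x \<in> topspace K \<Longrightarrow> y \<in> topspace K \<Longrightarrow> S = {p b x, p b y} \<Longrightarrow>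
      p b x \<noteq> p b y \<Longrightarrow> g b S x \<noteq> g b S y" for b S x y
    using someI_ex[OF ex[of S b]] unfolding g_def by blast+
  define G where "G x = (\<lambda>(b, S). g b S x)" for x
  define R where "R = product_topology (\<lambda>_ :: bool \<times> 'a set. euclideanreal) UNIV"
  define Q where "Q = subtopology R (G ` topspace K)"
  have GR: "continuous_map K R G"
    unfolding R_def using g by (auto simp: continuous_map_componentwise G_def split: prod.split)
  have topQ: "topspace Q = G ` topspace K"
    by (auto simp: Q_def R_def)
  have GQ: "continuous_map K Q G"
    unfolding Q_def using GR by (simp add: continuous_map_in_subtopology)
  have hQ: "Hausdorff_space Q"
    unfolding Q_def R_def
    by (intro Hausdorff_space_subtopology) (simp add: Hausdorff_space_product_topology)
  have cQ: "compact_space Q"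
    unfolding Q_def using K(1) GR
    by (intro compact_space_subtopology image_compactin) (simp_all only: compact_space_def)
  have quot: "quotient_map K Q G"
    using GQ topQ continuous_imp_closed_map[OF GQ K(1) hQ]
    by (simp add: continuous_closed_imp_quotient_map)
  have factor: "f x = f y" if "x \<in> topspace K" "y \<in> topspace K" "G x = G y" for x y
  proof -
    have eq: "g b S x = g b S y" for b S
      using fun_cong[OF that(3), of "(b, S)"] by (simp add: G_def)
    have "p b x = p b y" for b using sep[OF that(1,2) refl, of b] eq by blast
    from this[of True] this[of False] show ?thesis by (simp add: p_def prod_eq_iff)
  qed
  define h where "h = f \<circ> inv_into (topspace K) G"
  have hG: "h (G x) = f x" if "x \<in> topspace K" for x
    unfolding h_def o_def using that
    by (intro factor) (auto intro: inv_into_into f_inv_into_f)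
  have "continuous_map K (prod_topology X X) (h \<circ> G)"
    using f by (rule continuous_map_eq) (simp add: hG)
  with quot have h: "continuous_map Q (prod_topology X X) h"
    by (rule continuous_compose_quotient_map)
  have "inj (\<lambda>F :: bool \<times> 'a set \<Rightarrow> real.
      {index_code n i | n i. F i < real_of_rat (nat_to_rat_surj n)})"
    by (rule inj_real_code[OF inj_index_code])
  then have "closedin Q {z \<in> topspace Q. h z \<in> ?D}"
    using k2_closedin_transport[OF X[unfolded k2_Hausdorff_space_def] cQ hQ h]
    by (blast intro: inj_on_subset)
  then have "closedin K {x \<in> topspace K. G x \<in> {z \<in> topspace Q. h z \<in> ?D}}"
    by (rule closedin_continuous_map_preimage[OF GQ])
  moreover have "{x \<in> topspace K. G x \<in> {z \<in> topspace Q. h z \<in> ?D}} =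
      {x \<in> topspace K. f x \<in> ?D}"
    using topQ by (intro Collect_cong) (simp add: hG cong: conj_cong)
  ultimately show "closedin K {x \<in> topspace K. f x \<in> ?D}" by simp
qed

end

theory Submission
  imports Defs
begin

text \<open>
  The implications rest on one fact about a weakly Hausdorff space: a continuous image \<open>B\<close> of a
  compact Hausdorff space is itself Hausdorff, because the map onto \<open>B\<close> is closed and closed
  continuous maps preserve normality (\<open>weakly_Hausdorff_compact_image\<close>). The equalizer of two
  maps from a compact Hausdorff space is therefore computed inside a Hausdorff space, which gives
  \<open>k\<^sub>2\<close>-Hausdorff. Unique sequential limits follow by testing with the convergent sequence
  \<open>\<omega> + 1\<close>, and \<open>T\<^sub>1\<close> from constant sequences. The remaining steps are direct.

  The six separating examples are the following.

    \<^item> Not \<open>US\<close>: in the cofinite topology a sequence of distinct points converges to every point.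

    \<^item> Not Hausdorff: the compact subsets of the cocountable topology are finite, hence discrete,
      but any two nonempty open sets meet.

    \<^item> Not \<open>k\<^sub>1\<close>-Hausdorff: the one-point compactification \<open>Q\<close> of the rationals is compact and KC,
      but not Hausdorff because the rationals are not locally compact.

    \<^item> Not KC: the square of \<open>Q\<close>. Products of weakly Hausdorff spaces are weakly Hausdorff, but
      the diagonal is compact and, as \<open>Q\<close> is not Hausdorff, not closed.

    \<^item> Not weakly Hausdorff: the one-point compactification of the cocountable topology. A map into
      it from a compact Hausdorff space is locally constant away from the fibre over infinity, so two
      maps that differ at a point differ nearby. But a discrete set together with
      infinity is a continuous image of the one-point compactification of that set, and it is not
      closed when it is uncountable and proper.

    \<^item> Not \<open>k\<^sub>2\<close>-Hausdorff: double the last point of \<open>\<omega>\<^sub>1 + 1\<close>. The two inclusions of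
      \<open>\<omega>\<^sub>1 + 1\<close> agree exactly off that point, which is not isolated; but no sequence of other
      points converges to it, so sequences do not notice the doubling.

  All of these have at most continuum many points and so live on the type of real numbers. The space
  \<open>\<omega>\<^sub>1 + 1\<close> is realised as the set of initial segments of an uncountable well-order with countable
  proper initial segments, a closed subset of a power of the two-point space; this gives
  compactness and the Hausdorff property at once.
\<close>


section \<open>The implications\<close>

lemma Hausdorff_imp_k1_Hausdorff_space:
  "Hausdorff_space X \<Longrightarrow> k1_Hausdorff_space X"
  unfolding k1_Hausdorff_space_def by (simp add: Hausdorff_space_subtopology)

text \<open>
  Adding one limit point \<open>x\<close> to a compact set \<open>C\<close> keeps it compact, hence Hausdorff, and there \<open>C\<close>
  is closed.
\<close>

lemma k1_Hausdorff_imp_kc_space: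
  assumes X: "k1_Hausdorff_space X"
  shows "kc_space X"
  unfolding kc_space_def
proof (intro allI impI)
  fix C assume C: "compactin X C"
  then have sub: "C \<subseteq> topspace X" by (rule compactin_subset_topspace)
  have "x \<in> C" if x: "x \<in> X closure_of C" for x
  proof (rule ccontr)
    assume "x \<notin> C"
    let ?Y = "subtopology X (insert x C)"
    have xt: "x \<in> topspace X" using x by (simp add: in_closure_of)
    then have "compactin X (insert x C)" using C compactin_Un[of X "{x}" C] by simp
    then have "Hausdorff_space ?Y" using X by (simp add: k1_Hausdorff_space_def)
    moreover have "compactin ?Y C" using C by (simp add: compactin_subtopology subset_insertI)
    ultimately have "closedin ?Y C" by (rule compactin_imp_closedin)
    then obtain T where T: "closedin X T" "C = T \<inter> insert x C"
      by (auto simp: closedin_subtopology)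
    have "C \<subseteq> T" using T(2) by blast
    then have "x \<in> T" using closure_of_minimal[OF _ T(1)] x by blast
    then show False using T(2) \<open>x \<notin> C\<close> by blast
  qed
  then show "closedin X C"
    using sub by (metis closedin_closure_of closure_of_subset subsetI subset_antisym)
qed

lemma kc_imp_weakly_Hausdorff_space:
  "kc_space X \<Longrightarrow> weakly_Hausdorff_space X"
  unfolding weakly_Hausdorff_space_def kc_space_def
  by (metis compact_space_def image_compactin)

lemma weakly_Hausdorff_imp_t1_space:
  assumes "weakly_Hausdorff_space X"
  shows "t1_space X"
  unfolding t1_space_closedin_singleton
proof
  fix x assume "x \<in> topspace X"
  then have "continuous_map (discrete_topology {()}) X (\<lambda>_. x)" by simp
  from weakly_Hausdorff_spaceD[OF assms _ _ this] show "closedin X {x}"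
    by (simp add: compact_space_discrete_topology Hausdorff_space_discrete_topology)
qed

text \<open>
  Closed subsets of \<open>K\<close> are again compact Hausdorff test spaces, so \<open>f\<close> is a closed map onto its
  image. Normality passes to the image along such a map.
\<close>

lemma weakly_Hausdorff_compact_image:
  assumes X: "weakly_Hausdorff_space X"
    and K: "compact_space K" "Hausdorff_space K" and f: "continuous_map K X f"
  shows "Hausdorff_space (subtopology X (f ` topspace K))"
proof (rule Hausdorff_normal_space_closed_continuous_map_image)
  let ?B = "f ` topspace K"
  have sub: "?B \<subseteq> topspace X" using f by (rule continuous_map_image_subset_topspace)
  show "normal_space K" using K compact_Hausdorff_or_regular_imp_normal_space by blast
  show "continuous_map K (subtopology X ?B) f" using f by (simp add: continuous_map_in_subtopology)
  show "?B = topspace (subtopology X ?B)" using sub by auto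
  show "t1_space (subtopology X ?B)"
    using X by (simp add: weakly_Hausdorff_imp_t1_space t1_space_subtopology)
  show "closed_map K (subtopology X ?B) f"
    unfolding closed_map_def
  proof (intro allI impI)
    fix C assume C: "closedin K C"
    have "closedin X (f ` topspace (subtopology K C))"
      using K f C
      by (intro weakly_Hausdorff_spaceD[OF X])
        (auto intro: compact_space_subtopology closedin_compact_space Hausdorff_space_subtopology
          continuous_map_from_subtopology)
    moreover have "topspace (subtopology K C) = C" using closedin_subset[OF C] by auto
    ultimately show "closedin (subtopology X ?B) (f ` C)"
      using closedin_subset[OF C] by (metis closedin_subset_topspace image_mono)
  qed
qed

text \<open>
  The equalizer of \<open>p\<close> and \<open>q\<close> lies in the closed set \<open>p -` B\<close>, where \<open>B\<close> is the image of \<open>q\<close>; there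
  both maps have values in the Hausdorff space \<open>B\<close>.
\<close>

lemma weakly_Hausdorff_imp_k2_Hausdorff_space:
  assumes X: "weakly_Hausdorff_space X"
  shows "k2_Hausdorff_space X"
  unfolding k2_Hausdorff_space_def k2_closedin_def
proof (intro conjI allI impI)
  let ?D = "{(x, x) |x. x \<in> topspace X}"
  show "?D \<subseteq> topspace (prod_topology X X)" by auto
  fix K :: "'a test_point topology" and f
  assume "compact_space K \<and> Hausdorff_space K \<and> continuous_map K (prod_topology X X) f"
  then have K: "compact_space K" "Hausdorff_space K"
    and p: "continuous_map K X (fst \<circ> f)" and q: "continuous_map K X (snd \<circ> f)"
    by (auto simp: continuous_map_pairwise)
  define B where "B = (snd \<circ> f) ` topspace K"
  define L where "L = {x \<in> topspace K. (fst \<circ> f) x \<in> B}"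
  have "closedin X B" unfolding B_def by (rule weakly_Hausdorff_spaceD[OF X K q])
  then have L: "closedin K L" unfolding L_def by (rule closedin_continuous_map_preimage[OF p])
  have "Hausdorff_space (subtopology X B)"
    unfolding B_def by (rule weakly_Hausdorff_compact_image[OF X K q])
  moreover have "continuous_map (subtopology K L) (subtopology X B) (fst \<circ> f)"
    "continuous_map (subtopology K L) (subtopology X B) (snd \<circ> f)"
    using p q unfolding continuous_map_in_subtopology
    by (auto simp: L_def B_def intro!: continuous_map_from_subtopology)
  ultimately have "closedin (subtopology K L)
      {x \<in> topspace (subtopology K L). (fst \<circ> f) x = (snd \<circ> f) x}"
    by (rule closedin_continuous_maps_eq)
  then have "closedin K {x \<in> topspace (subtopology K L). (fst \<circ> f) x = (snd \<circ> f) x}"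
    using L by (rule closedin_trans_full)
  moreover have "{x \<in> topspace (subtopology K L). (fst \<circ> f) x = (snd \<circ> f) x} =
      {x \<in> topspace K. f x \<in> ?D}"
    using continuous_map_image_subset_topspace[OF q]
    by (auto simp: L_def B_def prod_eq_iff intro: rev_image_eqI)
  ultimately show "closedin K {x \<in> topspace K. f x \<in> ?D}" by simp
qed

text \<open>
  The sequence extends in two ways to the one-point compactification of the discrete natural
  numbers, with values \<open>l\<close> and \<open>m\<close> at infinity. The extensions agree on a dense set.
\<close>

lemma k2_Hausdorff_imp_US_space:
  assumes X: "k2_Hausdorff_space X"
  shows "US_space X"
  unfolding US_space_def
proof (intro allI impI)
  fix s :: "nat \<Rightarrow> 'a" and l m
  assume "range s \<subseteq> topspace X \<and> limitin X s l sequentially \<and> limitin X s m sequentially"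
  then have s: "\<And>n. s n \<in> topspace X" and l: "limitin X s l sequentially"
    and m: "limitin X s m sequentially" by auto
  define K where "K = Alexandroff_compactification (discrete_topology (UNIV :: nat set))"
  define g where "g c = case_option c s" for c
  have g: "continuous_map K X (g c)" if c: "limitin X s c sequentially" for c
    unfolding continuous_map_def
  proof (intro conjI allI impI)
    show "g c \<in> topspace K \<rightarrow> topspace X"
      using s limitin_topspace[OF c] by (auto simp: g_def K_def)
    fix U assume U: "openin X U"
    show "openin K {x \<in> topspace K. g c x \<in> U}"
    proof (cases "c \<in> U")
      case True
      then have "\<forall>\<^sub>F n in sequentially. s n \<in> U" using c U by (auto simp: limitin_def)
      then have "finite {n. s n \<notin> U}"
        by (simp add: eventually_cofinite flip: cofinite_eq_sequentially)
      moreover have "{x \<in> topspace K. g c x \<in> U} = insert None (Some ` (UNIV - {n. s n \<notin> U}))"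
        using True
        by (intro set_eqI, rename_tac x, case_tac x) (auto simp: g_def K_def)
      ultimately show ?thesis
        by (auto simp: K_def openin_Alexandroff_compactification compactin_discrete_topology)
    next
      case False
      then have "{x \<in> topspace K. g c x \<in> U} = Some ` {n. s n \<in> U}"
        by (auto simp: g_def K_def image_iff split: option.splits)
      then show ?thesis by (simp add: K_def)
    qed
  qed
  let ?D = "{(x, x) |x. x \<in> topspace X}"
  have K: "compact_space K" "Hausdorff_space K"
    by (auto simp: K_def Hausdorff_space_Alexandroff_compactification
        Hausdorff_space_discrete_topology locally_compact_space_discrete_topology)
  moreover have "continuous_map K (prod_topology X X) (\<lambda>x. (g l x, g m x))"
    using g l m by (simp add: continuous_map_paired)
  ultimately have cl: "closedin K {x \<in> topspace K. (g l x, g m x) \<in> ?D}"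
    using k2_Hausdorff_spaceD[OF X] unfolding k2_closedin_def by blast
  show "l = m"
  proof (rule ccontr)
    assume "l \<noteq> m"
    then have "{x \<in> topspace K. (g l x, g m x) \<in> ?D} = Some ` UNIV"
      using s by (auto simp: g_def K_def image_iff split: option.splits)
    with cl have "compactin (discrete_topology UNIV) (UNIV :: nat set)"
      by (simp add: K_def)
    then show False by (simp add: compactin_discrete_topology)
  qed
qed

lemma US_imp_t1_space:
  assumes X: "US_space X"
  shows "t1_space X"
  unfolding t1_space_def
proof (intro ballI impI, rule ccontr)
  fix x y assume xy: "x \<in> topspace X" "y \<in> topspace X" "x \<noteq> y"
    and "\<not> (\<exists>U. openin X U \<and> x \<in> U \<and> y \<notin> U)"
  then have "limitin X (\<lambda>n::nat. y) x sequentially" "limitin X (\<lambda>n::nat. y) y sequentially"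
    by (auto simp: limitin_def intro!: always_eventually)
  moreover have "range (\<lambda>n::nat. y) \<subseteq> topspace X" using xy(2) by auto
  ultimately have "x = y" using X unfolding US_space_def by blast
  then show False using xy(3) by simp
qed


section \<open>Topologies with small closed sets\<close>

definition small_closed_topology :: "('a set \<Rightarrow> bool) \<Rightarrow> 'a topology" where
  "small_closed_topology small = topology (\<lambda>U. U = {} \<or> small (- U))"

lemma openin_small_closed_topology:
  assumes "\<And>S T. small T \<Longrightarrow> S \<subseteq> T \<Longrightarrow> small S" "\<And>S T. small S \<Longrightarrow> small T \<Longrightarrow> small (S \<union> T)"
  shows "openin (small_closed_topology small) U \<longleftrightarrow> U = {} \<or> small (- U)"
proof -
  have "istopology (\<lambda>U. U = {} \<or> small (- U))"
    unfolding istopology_def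
  proof (intro conjI allI impI)
    fix S T :: "'a set" assume "S = {} \<or> small (- S)" "T = {} \<or> small (- T)"
    then show "S \<inter> T = {} \<or> small (- (S \<inter> T))" using assms(2) by (auto simp: Compl_Int)
  next
    fix \<K> :: "'a set set" assume K: "\<forall>S\<in>\<K>. S = {} \<or> small (- S)"
    show "\<Union>\<K> = {} \<or> small (- \<Union>\<K>)"
    proof (cases "\<Union>\<K> = {}")
      case False
      then obtain S where "S \<in> \<K>" "S \<noteq> {}" by blast
      then have "small (- S)" "- \<Union>\<K> \<subseteq> - S" using K by auto
      then show ?thesis using assms(1) by blast
    qed simp
  qed
  then show ?thesis by (simp add: small_closed_topology_def)
qed

definition cofinite_topology :: "'a topology" where
  "cofinite_topology = small_closed_topology finite"

definition cocountable_topology :: "'a topology" where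
  "cocountable_topology = small_closed_topology countable"

lemma openin_cofinite_topology: "openin cofinite_topology U \<longleftrightarrow> U = {} \<or> finite (- U)"
  unfolding cofinite_topology_def
  by (rule openin_small_closed_topology) (auto intro: finite_subset)

lemma openin_cocountable_topology: "openin cocountable_topology U \<longleftrightarrow> U = {} \<or> countable (- U)"
  unfolding cocountable_topology_def
  by (rule openin_small_closed_topology) (auto intro: countable_subset)

lemma topspace_cofinite_topology [simp]: "topspace cofinite_topology = UNIV"
  using openin_cofinite_topology[of UNIV] openin_subset by fastforce

lemma topspace_cocountable_topology [simp]: "topspace cocountable_topology = UNIV"
  using openin_cocountable_topology[of UNIV] openin_subset by fastforce

lemma t1_space_cofinite_topology: "t1_space cofinite_topology"
  unfolding t1_space_closedin_singleton closedin_def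
  by (simp add: openin_cofinite_topology flip: Compl_eq_Diff_UNIV)

lemma not_US_space_cofinite_topology:
  assumes "infinite (UNIV :: 'a set)"
  shows "\<not> US_space (cofinite_topology :: 'a topology)"
proof
  assume US: "US_space (cofinite_topology :: 'a topology)"
  obtain s :: "nat \<Rightarrow> 'a" where s: "inj s" using assms by (auto simp: infinite_iff_countable_subset)
  have "limitin cofinite_topology s l sequentially" for l
    unfolding limitin_def
  proof (intro conjI allI impI)
    fix U assume "openin cofinite_topology U \<and> l \<in> U"
    then have "finite (s -` (- U))"
      using s by (auto simp: openin_cofinite_topology intro: finite_vimageI)
    then show "\<forall>\<^sub>F n in sequentially. s n \<in> U"
      by (simp add: eventually_cofinite vimage_def flip: cofinite_eq_sequentially)
  qed simp
  then have "s 0 = s 1"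
    by (intro US[unfolded US_space_def, rule_format, of s]) simp
  then show False using s by (auto dest: injD)
qed

text \<open>
  If \<open>A\<close> is a countably infinite subset, the open sets that meet \<open>A\<close> in a single point cover the
  space, and no finite subfamily covers \<open>A\<close>.
\<close>

lemma compact_space_countable_closed_imp_finite:
  assumes X: "compact_space X"
    and cl: "\<And>A. A \<subseteq> topspace X \<Longrightarrow> countable A \<Longrightarrow> closedin X A"
  shows "finite (topspace X)"
proof (rule ccontr)
  assume "infinite (topspace X)"
  then obtain A where A: "A \<subseteq> topspace X" "countable A" "infinite A"
    by (meson infinite_countable_subset')
  have op: "openin X (topspace X - (A - {a}))" for a
    using cl[of "A - {a}"] A by (auto simp: closedin_def)
  obtain \<F> where F: "finite \<F>" "\<F> \<subseteq> (\<lambda>a. topspace X - (A - {a})) ` A" "topspace X \<subseteq> \<Union>\<F>"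
  proof -
    have "A \<noteq> {}" using A(3) by auto
    then have "topspace X \<subseteq> \<Union> ((\<lambda>a. topspace X - (A - {a})) ` A)" by auto
    then show thesis
      using X op that unfolding compact_space_alt by (metis (no_types, lifting) imageE)
  qed
  from finite_subset_image[OF F(1,2)] obtain B
    where B: "B \<subseteq> A" "finite B" "\<F> = (\<lambda>a. topspace X - (A - {a})) ` B" by blast
  have "A \<subseteq> B"
  proof
    fix a assume "a \<in> A"
    then obtain b where "b \<in> B" "a \<in> topspace X - (A - {b})" using F(3) A(1) B(3) by blast
    then show "a \<in> B" using \<open>a \<in> A\<close> by blast
  qed
  then show False using A(3) B(2) finite_subset by blast
qed

lemma k1_Hausdorff_space_cocountable_topology: "k1_Hausdorff_space cocountable_topology"
  unfolding k1_Hausdorff_space_def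
proof (intro allI impI)
  fix S :: "'a set" assume S: "compactin cocountable_topology S"
  let ?Y = "subtopology cocountable_topology S"
  have cl: "closedin ?Y A" if "A \<subseteq> topspace ?Y" "countable A" for A
  proof -
    have "closedin cocountable_topology A"
      using that(2) by (simp add: closedin_def openin_cocountable_topology flip: Compl_eq_Diff_UNIV)
    then show ?thesis using that(1) by (auto simp: closedin_subtopology)
  qed
  have "finite (topspace ?Y)"
    using S cl by (intro compact_space_countable_closed_imp_finite) (auto simp: compactin_subspace)
  moreover have "t1_space ?Y"
    unfolding t1_space_closedin_singleton using cl by auto
  ultimately show "Hausdorff_space ?Y"
    by (metis finite_t1_space_imp_discrete_topology Hausdorff_space_discrete_topology)
qed

lemma not_Hausdorff_space_cocountable_topology:
  assumes "uncountable (UNIV :: 'a set)"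
  shows "\<not> Hausdorff_space (cocountable_topology :: 'a topology)"
proof
  assume H: "Hausdorff_space (cocountable_topology :: 'a topology)"
  have "infinite (UNIV :: 'a set)" using assms countable_finite by blast
  then obtain x y :: 'a where "x \<noteq> y"
    using ex_new_if_finite[of "{undefined}"] by auto
  then obtain U V where UV: "openin cocountable_topology U" "openin cocountable_topology V"
      "x \<in> U" "y \<in> V" "disjnt U V"
    using H unfolding Hausdorff_space_def by force
  then have "countable (- U \<union> - V)" by (auto simp: openin_cocountable_topology)
  moreover have "- U \<union> - V = UNIV" using UV(5) by (auto simp: disjnt_def)
  ultimately show False using assms by simp
qed


section \<open>Compactifying the cocountable topology\<close>

text \<open>
  This is the one-point compactification of the cocountable topology on the points other than \<open>p\<close>,
  with \<open>p\<close> as the point at infinity: its neighbourhoods are cofinite because the compact sets of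
  the cocountable topology are finite.
\<close>

definition cocountable_compactification :: "'a \<Rightarrow> 'a topology" where
  "cocountable_compactification p =
     topology (\<lambda>U. if p \<in> U then finite (- U) else U = {} \<or> countable (- U))"

lemma openin_cocountable_compactification:
  "openin (cocountable_compactification p) U \<longleftrightarrow>
    (if p \<in> U then finite (- U) else U = {} \<or> countable (- U))"
proof -
  let ?op = "\<lambda>U. if p \<in> U then finite (- U) else U = {} \<or> countable (- U)"
  have "istopology ?op"
    unfolding istopology_def
  proof (intro conjI allI impI)
    fix S T :: "'a set" assume "?op S" "?op T"
    then show "?op (S \<inter> T)"
      by (auto simp: Compl_Int countable_finite split: if_splits)
  next
    fix \<K> :: "'a set set" assume K: "\<forall>S\<in>\<K>. ?op S"
    show "?op (\<Union>\<K>)"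
    proof (cases "\<exists>S\<in>\<K>. p \<in> S")
      case True
      then obtain S where "S \<in> \<K>" "p \<in> S" by blast
      moreover from this have "- \<Union>\<K> \<subseteq> - S" "finite (- S)" using K by auto
      ultimately show ?thesis using finite_subset[of "- \<Union>\<K>" "- S"] by auto
    next
      case False
      show ?thesis
      proof (cases "\<Union>\<K> = {}")
        case True
        show ?thesis unfolding True by simp
      next
        case ne: False
        then obtain S where S: "S \<in> \<K>" "S \<noteq> {}" by blast
        then have "- \<Union>\<K> \<subseteq> - S" "countable (- S)" using K False by auto
        then have "countable (- \<Union>\<K>)" by (rule countable_subset)
        moreover have "p \<notin> \<Union>\<K>" using False by blast
        ultimately show ?thesis by (subst if_not_P) blast+
      qed
    qed
  qed
  then show ?thesis by (simp add: cocountable_compactification_def)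
qed

lemma topspace_cocountable_compactification [simp]:
  "topspace (cocountable_compactification p) = UNIV"
  using openin_cocountable_compactification[of p UNIV] openin_subset by fastforce

lemma closedin_cocountable_compactification_finite:
  "finite A \<Longrightarrow> closedin (cocountable_compactification p) A"
  by (simp add: closedin_def openin_cocountable_compactification countable_finite
      flip: Compl_eq_Diff_UNIV)

lemma compactin_cocountable_compactification_imp_finite:
  assumes S: "compactin (cocountable_compactification p) S" and p: "p \<notin> S"
  shows "finite S"
proof -
  let ?Y = "subtopology (cocountable_compactification p) S"
  have "closedin ?Y A" if A: "A \<subseteq> topspace ?Y" "countable A" for A
  proof -
    have "closedin (cocountable_compactification p) (insert p A)"
      using A(2) by (simp add: closedin_def openin_cocountable_compactification
          flip: Compl_eq_Diff_UNIV)
    moreover have "A = insert p A \<inter> S" using A(1) p by auto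
    ultimately show ?thesis unfolding closedin_subtopology by blast
  qed
  then have "finite (topspace ?Y)"
    using S by (intro compact_space_countable_closed_imp_finite) (auto simp: compactin_subspace)
  then show ?thesis by simp
qed

text \<open>
  The fibre is closed and misses the fibre over \<open>p\<close>. By normality it has a neighbourhood whose
  closure \<open>C\<close> still misses that fibre. The image of \<open>C\<close> is compact without \<open>p\<close>, hence finite, so
  inside this neighbourhood the fibre is the complement of finitely many other fibres.
\<close>

lemma openin_fibre_cocountable_compactification:
  assumes K: "compact_space K" "Hausdorff_space K"
    and f: "continuous_map K (cocountable_compactification p) f"
    and z: "z \<in> topspace K" "f z \<noteq> p"
  shows "openin K {w \<in> topspace K. f w = f z}"
proof -
  let ?Y = "cocountable_compactification p"
  let ?E = "{w \<in> topspace K. f w = f z}" and ?U = "{w \<in> topspace K. f w \<in> - {p}}"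
  have op: "openin K {w \<in> topspace K. f w \<in> U}" if "finite (- U)" for U
  proof -
    have "openin ?Y U"
      using that by (simp add: openin_cocountable_compactification countable_finite)
    then show ?thesis using f by (simp add: continuous_map_def)
  qed
  have "closedin K {w \<in> topspace K. f w \<in> {f z}}"
    by (rule closedin_continuous_map_preimage[OF f])
      (simp add: closedin_cocountable_compactification_finite)
  then have cE: "closedin K ?E" by simp
  have nK: "normal_space K" using K compact_Hausdorff_or_regular_imp_normal_space by blast
  have U: "openin K ?U" by (rule op) simp
  have EU: "?E \<subseteq> ?U" using z by auto
  obtain V C where V: "openin K V" "closedin K C" "?E \<subseteq> V" "V \<subseteq> C" "C \<subseteq> ?U"
  proof -
    obtain V where "openin K V" "?E \<subseteq> V" "K closure_of V \<subseteq> ?U"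
      using nK cE U EU unfolding normal_space_alt by meson
    then show thesis
      using that[of V "K closure_of V"] by (simp add: closure_of_subset openin_subset)
  qed
  have "compactin ?Y (f ` C)"
    using V(2) K(1) f by (meson closedin_compact_space image_compactin)
  then have "finite (f ` C)"
    using V(5) by (intro compactin_cocountable_compactification_imp_finite) auto
  then have "openin K {w \<in> topspace K. f w \<in> - (f ` C - {f z})}"
    by (intro op) (simp only: double_complement finite_Diff)
  then have "openin K (V \<inter> {w \<in> topspace K. f w \<in> - (f ` C - {f z})})"
    using V(1) by blast
  moreover have "V \<inter> {w \<in> topspace K. f w \<in> - (f ` C - {f z})} = ?E"
    using V(3,4) by auto
  ultimately show ?thesis by simp
qed

text \<open>
  If two maps differ at \<open>z\<close>, one of them, say \<open>g\<close>, has a value other than \<open>p\<close> there. Near \<open>z\<close> the map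
  \<open>g\<close> is constant and the other map avoids the closed point \<open>g z\<close>.
\<close>

lemma k2_Hausdorff_space_cocountable_compactification:
  "k2_Hausdorff_space (cocountable_compactification p)"
  unfolding k2_Hausdorff_space_def k2_closedin_def
proof (intro conjI allI impI)
  let ?Y = "cocountable_compactification p"
  let ?D = "{(x, x) |x. x \<in> topspace ?Y}"
  show "?D \<subseteq> topspace (prod_topology ?Y ?Y)" by auto
  fix K :: "'a test_point topology" and f
  assume "compact_space K \<and> Hausdorff_space K \<and> continuous_map K (prod_topology ?Y ?Y) f"
  then have K: "compact_space K" "Hausdorff_space K"
    and p: "continuous_map K ?Y (fst \<circ> f)" and q: "continuous_map K ?Y (snd \<circ> f)"
    by (auto simp: continuous_map_pairwise)
  have nb: "\<exists>N. openin K N \<and> z \<in> N \<and> (\<forall>w\<in>N. g w \<noteq> h w)"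
    if z: "z \<in> topspace K" "g z \<noteq> h z" "g z \<noteq> p"
      and g: "continuous_map K ?Y g" and h: "continuous_map K ?Y h" for g h z
  proof (intro exI conjI)
    have "openin ?Y (- {g z})" by (simp add: openin_cocountable_compactification)
    then have "openin K {w \<in> topspace K. h w \<in> - {g z}}"
      using h unfolding continuous_map_def by blast
    then show "openin K ({w \<in> topspace K. g w = g z} \<inter> {w \<in> topspace K. h w \<in> - {g z}})"
      using openin_fibre_cocountable_compactification[OF K g z(1,3)] by blast
  qed (use z in auto)
  have "openin K {z \<in> topspace K. (fst \<circ> f) z \<noteq> (snd \<circ> f) z}"
  proof (subst openin_subopen, intro ballI)
    fix z assume z: "z \<in> {z \<in> topspace K. (fst \<circ> f) z \<noteq> (snd \<circ> f) z}"
    then consider "(fst \<circ> f) z \<noteq> p" | "(snd \<circ> f) z \<noteq> p" by fastforce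
    then have "\<exists>N. openin K N \<and> z \<in> N \<and> (\<forall>w\<in>N. (fst \<circ> f) w \<noteq> (snd \<circ> f) w)"
    proof cases
      case 1
      then show ?thesis using nb[OF _ _ 1 p q] z by simp
    next
      case 2
      then show ?thesis using nb[OF _ _ 2 q p] z
        by (simp only: mem_Collect_eq eq_commute[of "(snd \<circ> f) _"]) blast
    qed
    then show "\<exists>T. openin K T \<and> z \<in> T \<and> T \<subseteq> {z \<in> topspace K. (fst \<circ> f) z \<noteq> (snd \<circ> f) z}"
      using openin_subset by blast
  qed
  moreover have "topspace K - {x \<in> topspace K. f x \<in> ?D} =
      {z \<in> topspace K. (fst \<circ> f) z \<noteq> (snd \<circ> f) z}"
    by (auto simp: prod_eq_iff)
  ultimately show "closedin K {x \<in> topspace K. f x \<in> ?D}"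
    unfolding closedin_def by (simp only: Collect_subset simp_thms)
qed

text \<open>
  The set \<open>A\<close> is the image of the one-point compactification of the discrete space \<open>A - {p}\<close>, since
  neighbourhoods of \<open>p\<close> are cofinite. It is not closed: its complement is nonempty, misses \<open>p\<close>,
  and is not cocountable.
\<close>

lemma not_weakly_Hausdorff_space_cocountable_compactification:
  assumes A: "uncountable A" "A \<noteq> UNIV" and p: "p \<in> A"
  shows "\<not> weakly_Hausdorff_space (cocountable_compactification p)"
proof
  let ?Y = "cocountable_compactification p"
  assume Y: "weakly_Hausdorff_space ?Y"
  define K where "K = Alexandroff_compactification (discrete_topology (A - {p}))"
  define f where "f = case_option p id"
  have K: "compact_space K" "Hausdorff_space K"
    by (auto simp: K_def Hausdorff_space_Alexandroff_compactification
        Hausdorff_space_discrete_topology locally_compact_space_discrete_topology)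
  have "continuous_map K ?Y f"
    unfolding continuous_map_def
  proof (intro conjI allI impI)
    show "f \<in> topspace K \<rightarrow> topspace ?Y" by simp
    fix U assume U: "openin ?Y U"
    show "openin K {x \<in> topspace K. f x \<in> U}"
    proof (cases "p \<in> U")
      case True
      have "{x \<in> topspace K. f x \<in> U} = insert None (Some ` ((A - {p}) - (A - {p} - U)))"
        using True by (auto simp: f_def K_def)
      moreover have "finite (A - {p} - U)"
        using U True by (auto simp: openin_cocountable_compactification elim: finite_subset[rotated])
      moreover have "closedin (discrete_topology (A - {p})) (A - {p} - U)" by auto
      ultimately show ?thesis
        unfolding K_def openin_Alexandroff_compactification
        by (metis compactin_discrete_topology Diff_subset topspace_discrete_topology)
    next
      case False
      then have "{x \<in> topspace K. f x \<in> U} = Some ` (U \<inter> (A - {p}))"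
        by (auto simp: f_def K_def)
      then show ?thesis by (simp add: K_def)
    qed
  qed
  from weakly_Hausdorff_spaceD[OF Y K this] have "closedin ?Y (f ` topspace K)" .
  moreover have "f ` topspace K = A" using p by (force simp: f_def K_def)
  ultimately have "openin ?Y (- A)" by (simp add: closedin_def flip: Compl_eq_Diff_UNIV)
  then show False using A p by (auto simp: openin_cocountable_compactification)
qed


section \<open>The one-point compactification of the rationals and its square\<close>

text \<open>
  A compact set of rationals is closed in the real line. If it contained a neighbourhood of \<open>0\<close> in
  the rationals it would contain the closure of that neighbourhood, and so an interval.
\<close>

lemma not_locally_compact_space_Rats: "\<not> locally_compact_space (top_of_set (\<rat> :: real set))"
proof
  assume "locally_compact_space (top_of_set (\<rat> :: real set))"
  moreover have "0 \<in> topspace (top_of_set (\<rat> :: real set))" by simp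
  ultimately obtain U C where UC: "openin (top_of_set (\<rat> :: real set)) U" "compactin (top_of_set \<rat>) C"
      "0 \<in> U" "U \<subseteq> C"
    unfolding locally_compact_space_def by meson
  obtain T where T: "open T" "U = \<rat> \<inter> T" using UC(1) by (auto simp: openin_open)
  then obtain e :: real where e: "e > 0" "ball 0 e \<subseteq> T"
    using UC(3) by (metis IntE open_contains_ball)
  have C: "compact C" "C \<subseteq> \<rat>" using UC(2) by (auto simp: compactin_subtopology)
  have "T \<subseteq> closure (T \<inter> \<rat>)"
    using T(1) by (metis Rats_closure_real inf_top.right_neutral open_Int_closure_subset)
  also have "\<dots> \<subseteq> C"
    using C(1) T(2) UC(4) by (intro closure_minimal compact_imp_closed) auto
  finally have "ball (0::real) e \<subseteq> \<rat>" using e C by blast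
  then have "countable (ball (0::real) e)" using countable_rat countable_subset by blast
  then show False using e(1) uncountable_ball by blast
qed

definition compactified_Rats :: "real option topology" where
  "compactified_Rats = Alexandroff_compactification (top_of_set \<rat>)"

lemma kc_space_compactified_Rats: "kc_space compactified_Rats"
  unfolding compactified_Rats_def kc_space_Alexandroff_compactification
  by (simp add: Hausdorff_imp_kc_space Hausdorff_space_subtopology metrizable_imp_k_space
      metrizable_space_subtopology metrizable_space_euclidean)

lemma compact_space_compactified_Rats: "compact_space compactified_Rats"
  by (simp add: compactified_Rats_def)

lemma not_Hausdorff_space_compactified_Rats: "\<not> Hausdorff_space compactified_Rats"
  by (simp add: compactified_Rats_def Hausdorff_space_Alexandroff_compactification
      not_locally_compact_space_Rats)

lemma countable_topspace_compactified_Rats: "countable (topspace compactified_Rats)"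
  by (simp add: compactified_Rats_def countable_rat)

text \<open>
  The image of a test map lies in the product of the images of its components. That
  product is closed and Hausdorff, so the compact image is closed in it.
\<close>

lemma weakly_Hausdorff_space_prod_topology:
  assumes X: "weakly_Hausdorff_space X" and Y: "weakly_Hausdorff_space Y"
  shows "weakly_Hausdorff_space (prod_topology X Y)"
  unfolding weakly_Hausdorff_space_def
proof (intro allI impI)
  fix K :: "('a \<times> 'b) test_point topology" and f
  assume "compact_space K \<and> Hausdorff_space K \<and> continuous_map K (prod_topology X Y) f"
  then have K: "compact_space K" "Hausdorff_space K" and f: "continuous_map K (prod_topology X Y) f"
    and p: "continuous_map K X (fst \<circ> f)" and q: "continuous_map K Y (snd \<circ> f)"
    by (auto simp: continuous_map_pairwise)
  define B C where "B = (fst \<circ> f) ` topspace K" and "C = (snd \<circ> f) ` topspace K"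
  have cl: "closedin (prod_topology X Y) (B \<times> C)"
    unfolding B_def C_def closedin_prod_Times_iff
    using weakly_Hausdorff_spaceD[OF X K p] weakly_Hausdorff_spaceD[OF Y K q] by simp
  have "Hausdorff_space (subtopology (prod_topology X Y) (B \<times> C))"
    unfolding subtopology_Times B_def C_def Hausdorff_space_prod_topology
    using weakly_Hausdorff_compact_image[OF X K p] weakly_Hausdorff_compact_image[OF Y K q] by simp
  moreover have "compactin (prod_topology X Y) (f ` topspace K)"
    using K(1) f by (auto simp: compact_space_def intro: image_compactin)
  then have "compactin (subtopology (prod_topology X Y) (B \<times> C)) (f ` topspace K)"
    unfolding compactin_subtopology
    by (intro conjI image_subsetI) (simp_all add: B_def C_def mem_Times_iff)
  ultimately have "closedin (subtopology (prod_topology X Y) (B \<times> C)) (f ` topspace K)"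
    by (rule compactin_imp_closedin)
  then show "closedin (prod_topology X Y) (f ` topspace K)"
    using cl by (rule closedin_trans_full)
qed

lemma not_kc_space_square:
  assumes X: "compact_space X" "\<not> Hausdorff_space X"
  shows "\<not> kc_space (prod_topology X X)"
proof
  assume "kc_space (prod_topology X X)"
  moreover have "compactin (prod_topology X X) ((\<lambda>x. (x, x)) ` topspace X)"
    using X(1) by (intro image_compactin[where X = X])
      (simp_all add: compact_space_def continuous_map_paired)
  ultimately have "closedin (prod_topology X X) ((\<lambda>x. (x, x)) ` topspace X)"
    by (simp add: kc_space_def)
  then show False using X(2) by (simp add: Hausdorff_space_closedin_diagonal)
qed

lemma homeomorphic_weakly_Hausdorff_space:
  assumes hom: "X homeomorphic_space Y" and X: "weakly_Hausdorff_space X"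
  shows "weakly_Hausdorff_space Y"
  unfolding weakly_Hausdorff_space_def
proof (intro allI impI)
  fix K :: "'b test_point topology" and f
  assume "compact_space K \<and> Hausdorff_space K \<and> continuous_map K Y f"
  then have K: "compact_space K" "Hausdorff_space K" and f: "continuous_map K Y f" by auto
  obtain h g where hg: "homeomorphic_maps X Y h g" using hom by (auto simp: homeomorphic_space_def)
  then have "continuous_map K X (g \<circ> f)"
    using f by (auto simp: homeomorphic_maps_def intro: continuous_map_compose)
  from weakly_Hausdorff_spaceD[OF X K this] have "closedin X ((g \<circ> f) ` topspace K)" .
  moreover have "homeomorphic_map X Y h" using hg homeomorphic_maps_map by blast
  ultimately have "closedin Y (h ` ((g \<circ> f) ` topspace K))"
    using homeomorphic_map_closedness_eq by blast
  moreover have "h ` ((g \<circ> f) ` topspace K) = f ` topspace K"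
    using hg continuous_map_image_subset_topspace[OF f]
    by (force simp: homeomorphic_maps_def image_image)
  ultimately show "closedin Y (f ` topspace K)" by simp
qed

lemma countable_space_homeomorphic_real:
  assumes "countable (topspace X)"
  obtains Y :: "real topology" where "X homeomorphic_space Y"
proof -
  have "inj_on (real \<circ> to_nat_on (topspace X)) (topspace X)"
    using assms by (intro comp_inj_on inj_on_to_nat_on) (auto simp: inj_on_def)
  then obtain Y where "homeomorphic_map X Y (real \<circ> to_nat_on (topspace X))"
    by (rule transport_topology)
  then show thesis using that homeomorphic_map_imp_homeomorphic_space by blast
qed


section \<open>Doubling a point\<close>

text \<open>
  The space is \<open>K\<close> with the point \<open>x\<close> doubled: the copies are \<open>e x\<close> and \<open>x'\<close>, and the topology is the
  finest that makes both inclusions of \<open>K\<close> continuous. The inclusions agree exactly on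
  \<open>topspace K - {x}\<close>, which is not closed, so the space is not \<open>k\<^sub>2\<close>-Hausdorff. A sequence with two
  limits retracts to a sequence in \<open>K\<close> with the limit \<open>x\<close>; each copy is a closed point, so the
  sequence eventually avoids both, which the assumption on \<open>x\<close> forbids.
\<close>

lemma ex_US_not_k2_Hausdorff_by_doubling:
  fixes K :: "'k topology" and e :: "'k \<Rightarrow> 'u"
  assumes K: "compact_space K" "Hausdorff_space K"
    and x: "x \<in> K closure_of (topspace K - {x})"
    and seq: "\<And>s :: nat \<Rightarrow> 'k. range s \<subseteq> topspace K - {x} \<Longrightarrow> \<not> limitin K s x sequentially"
    and e: "inj_on e (topspace K)" and x': "x' \<notin> e ` topspace K"
  shows "\<exists>Y :: 'u topology. US_space Y \<and> \<not> k2_Hausdorff_space Y"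
proof -
  \<comment> \<open>The two inclusions, indexed by truth values to treat them together.\<close>
  define i where "i b = (if b then e(x := x') else e)" for b
  define C where "C = insert x' (e ` topspace K)"
  have xK: "x \<in> topspace K" using x by (simp add: in_closure_of)
  let ?op = "\<lambda>W. W \<subseteq> C \<and> (\<forall>b. openin K {z \<in> topspace K. i b z \<in> W})"
  have "istopology ?op"
    unfolding istopology_def
  proof (intro conjI allI impI)
    fix S T assume ST: "?op S" "?op T"
    show "S \<inter> T \<subseteq> C" using ST by auto
    have "{z \<in> topspace K. i b z \<in> S \<inter> T} =
      {z \<in> topspace K. i b z \<in> S} \<inter> {z \<in> topspace K. i b z \<in> T}" for b by auto
    then show "openin K {z \<in> topspace K. i b z \<in> S \<inter> T}" for b using ST by auto
  next
    fix \<K> assume K': "\<forall>S\<in>\<K>. ?op S"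
    then show "\<Union>\<K> \<subseteq> C" by auto
    have "{z \<in> topspace K. i b z \<in> \<Union>\<K>} = (\<Union>S\<in>\<K>. {z \<in> topspace K. i b z \<in> S})" for b by auto
    then show "openin K {z \<in> topspace K. i b z \<in> \<Union>\<K>}" for b using K' by auto
  qed
  define Y where "Y = topology ?op"
  have op: "openin Y W \<longleftrightarrow> ?op W" for W
    using \<open>istopology ?op\<close> by (simp add: Y_def)
  have iC: "i b z \<in> C" if "z \<in> topspace K" for b z
    using that by (auto simp: i_def C_def)
  have "{z \<in> topspace K. i b z \<in> C} = topspace K" for b using iC by auto
  then have "openin Y C" by (simp add: op)
  then have top: "topspace Y = C"
    using op[of "topspace Y"] openin_topspace openin_subset by (intro subset_antisym) blast+
  have cont: "continuous_map K Y (i b)" for b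
    using iC op by (auto simp: continuous_map_def top)
  \<comment> \<open>The retraction that identifies the two copies of \<open>x\<close>.\<close>
  define r where "r y = (if y = x' then x else inv_into (topspace K) e y)" for y
  have ri: "r (i b z) = z" if "z \<in> topspace K" for b z
    using that x' e by (auto simp: r_def i_def)
  have rC: "y = e (r y) \<or> y = x' \<and> r y = x" "r y \<in> topspace K" if "y \<in> C" for y
    using that x' e xK by (auto simp: r_def C_def)
  have r: "continuous_map Y K r"
    unfolding continuous_map_def
  proof (intro conjI allI impI)
    show "r \<in> topspace Y \<rightarrow> topspace K" using rC by (auto simp: top)
    fix U assume U: "openin K U"
    have "{z \<in> topspace K. i b z \<in> {y \<in> topspace Y. r y \<in> U}} = U" for b
      using openin_subset[OF U] ri iC by (auto simp: top)
    then show "openin Y {y \<in> topspace Y. r y \<in> U}"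
      using U by (auto simp: op top)
  qed
  have offx: "openin K (topspace K - {x})"
    using K(2) xK by (simp add: openin_diff Hausdorff_imp_t1_space closedin_Hausdorff_singleton)
  have opC: "openin Y (C - {i b x})" for b
  proof -
    have "{z \<in> topspace K. i c z \<in> C - {i b x}} = (if b = c then topspace K - {x} else topspace K)" for c
      using x' e xK by (auto simp: i_def C_def dest: inj_onD split: if_splits)
    then show ?thesis using offx by (auto simp: op)
  qed
  have "US_space Y"
    unfolding US_space_def
  proof (intro allI impI, rule ccontr)
    fix s :: "nat \<Rightarrow> 'u" and l m
    assume A: "range s \<subseteq> topspace Y \<and> limitin Y s l sequentially \<and> limitin Y s m sequentially"
      and lm: "l \<noteq> m"
    then have lim: "limitin K (r \<circ> s) (r l) sequentially" "limitin K (r \<circ> s) (r m) sequentially"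
      using continuous_map_limit[OF r] by blast+
    then have rlm: "r l = r m"
      by (intro limitin_Hausdorff_unique[OF lim _ K(2)]) simp
    have "l \<in> C" "m \<in> C" using A by (auto simp: limitin_def top)
    then have lm': "l = e x \<and> m = x' \<or> l = x' \<and> m = e x" and rl: "r l = x"
      using rC(1)[of l] rC(1)[of m] lm rlm by metis+
    have "openin Y (C - {e x})" "openin Y (C - {x'})"
      using opC[of False] opC[of True] by (simp_all add: i_def)
    moreover have "e x \<in> C - {x'}" "x' \<in> C - {e x}" using xK x' by (auto simp: C_def)
    ultimately have ev: "\<forall>\<^sub>F n in sequentially. s n \<in> C - {x'}"
        "\<forall>\<^sub>F n in sequentially. s n \<in> C - {e x}"
      using A lm' by (auto simp: limitin_def)
    have "\<forall>\<^sub>F n in sequentially. r (s n) \<in> topspace K - {x}"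
      using ev by eventually_elim (use rC in auto)
    then obtain N where N: "\<And>n. n \<ge> N \<Longrightarrow> r (s n) \<in> topspace K - {x}"
      by (auto simp: eventually_sequentially)
    have "limitin K (\<lambda>n. (r \<circ> s) (n + N)) x sequentially"
      by (rule limitin_sequentially_offset) (rule lim(1)[unfolded rl])
    moreover have "range (\<lambda>n. (r \<circ> s) (n + N)) \<subseteq> topspace K - {x}"
      by (rule image_subsetI) (simp only: o_apply N le_add2)
    ultimately show False using seq by blast
  qed
  moreover have "\<not> k2_Hausdorff_space Y"
  proof
    assume "k2_Hausdorff_space Y"
    moreover have "continuous_map K (prod_topology Y Y) (\<lambda>z. (i True z, i False z))"
      using cont by (simp add: continuous_map_paired)
    ultimately have "closedin K {z \<in> topspace K. (i True z, i False z) \<in> {(y, y) |y. y \<in> topspace Y}}"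
      using K k2_Hausdorff_spaceD[of Y] unfolding k2_closedin_def by blast
    moreover have "{z \<in> topspace K. (i True z, i False z) \<in> {(y, y) |y. y \<in> topspace Y}} =
        topspace K - {x}"
      using x' xK by (auto simp: i_def top C_def)
    ultimately have "closedin K (topspace K - {x})" by simp
    then show False using x by (simp add: closure_of_closedin)
  qed
  ultimately show ?thesis by blast
qed


section \<open>A compact space with a point that sequences do not reach\<close>

text \<open>
  Well-order the reals. If some initial segment is uncountable, the least such segment is taken for
  \<open>A\<close>; otherwise all of the reals.
\<close>

lemma ex_omega1_order:
  obtains A :: "real set" and lt :: "real \<Rightarrow> real \<Rightarrow> bool"
  where "uncountable A" "\<And>a. a \<in> A \<Longrightarrow> countable {b. lt b a}" "wfP lt" "transp lt"
    "\<And>a b. lt b a \<Longrightarrow> a \<in> A \<Longrightarrow> b \<in> A" "\<And>a b. a \<noteq> b \<Longrightarrow> lt a b \<or> lt b a"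
proof -
  obtain r :: "real rel" where r: "well_order_on UNIV r" using well_order_on by blast
  define lt where "lt a b \<longleftrightarrow> (a, b) \<in> r - Id" for a b
  have lin: "linear_order_on UNIV r" and "wf (r - Id)" using r by (auto simp: well_order_on_def)
  moreover have "r - Id = {(a, b). lt a b}" by (auto simp: lt_def)
  ultimately have wf: "wfP lt" by (simp add: wfp_def)
  have trans: "lt a c" if "lt a b" "lt b c" for a b c
    using lin that unfolding lt_def linear_order_on_def partial_order_on_def preorder_on_def
    by (auto dest: transD antisymD)
  have total: "a \<noteq> b \<Longrightarrow> lt a b \<or> lt b a" for a b
    using lin unfolding lt_def linear_order_on_def by (auto simp: total_on_def)
  have unc: "uncountable (UNIV :: real set)" by (rule uncountable_UNIV_real)
  show thesis
  proof (cases "\<exists>a. uncountable {b. lt b a}")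
    case False
    then show ?thesis using that[of UNIV lt] unc wf trans total by (auto simp: transp_def)
  next
    case True
    define Q where "Q = {a. uncountable {b. lt b a}}"
    have "Q \<noteq> {}" using True by (simp add: Q_def)
    then obtain a where "a \<in> Q" "\<forall>c. lt c a \<longrightarrow> c \<notin> Q"
      using wf unfolding wfp_iff_ex_minimal by meson
    then have a: "uncountable {b. lt b a}" and min: "\<And>c. lt c a \<Longrightarrow> countable {b. lt b c}"
      by (auto simp: Q_def)
    show ?thesis
      using that[of "{b. lt b a}" lt] a min wf trans total by (auto simp: transp_def)
  qed
qed

text \<open>
  The points are the indicator functions of the initial segments of \<open>A\<close>, and \<open>x\<close> is the whole of \<open>A\<close>.
  Countably many proper initial segments are countable and have a countable union, so some \<open>a \<in> A\<close>
  lies in none of them and \<open>{f. f a}\<close> separates them from \<open>x\<close>. On the other hand finitely many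
  coordinates, which is all that a basic neighbourhood of \<open>x\<close> constrains, are matched by some
  proper initial segment. The code \<open>e\<close> shows that there are no more points than reals and leaves
  \<open>- 1\<close> free for a further point.
\<close>

lemma ex_compact_Hausdorff_sequentially_isolated_point:
  obtains K :: "(real \<Rightarrow> bool) topology" and x and e :: "(real \<Rightarrow> bool) \<Rightarrow> real"
  where "compact_space K" "Hausdorff_space K" "x \<in> K closure_of (topspace K - {x})"
    "\<And>s :: nat \<Rightarrow> _. range s \<subseteq> topspace K - {x} \<Longrightarrow> \<not> limitin K s x sequentially"
    "inj_on e (topspace K)" "- 1 \<notin> e ` topspace K"
proof -
  obtain A :: "real set" and lt where unc: "uncountable A"
    and seg: "\<And>a. a \<in> A \<Longrightarrow> countable {b. lt b a}" and wf: "wfP lt" and trans: "transp lt"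
    and down: "\<And>a b. lt b a \<Longrightarrow> a \<in> A \<Longrightarrow> b \<in> A" and total: "\<And>a b. a \<noteq> b \<Longrightarrow> lt a b \<or> lt b a"
    using ex_omega1_order by metis
  define P where "P = product_topology (\<lambda>_ :: real. discrete_topology (UNIV :: bool set)) UNIV"
  define D where "D = {f. (\<forall>a. a \<notin> A \<longrightarrow> \<not> f a) \<and> (\<forall>a b. lt b a \<longrightarrow> f a \<longrightarrow> f b)}"
  define K where "K = subtopology P D"
  define x where "x a \<longleftrightarrow> a \<in> A" for a
  have topP: "topspace P = UNIV" by (auto simp: P_def)
  have topK: "topspace K = D" by (simp add: K_def topP)
  have P: "compact_space P" "Hausdorff_space P"
    by (simp_all add: P_def compact_space_product_topology Hausdorff_space_product_topology
        compact_space_discrete_topology Hausdorff_space_discrete_topology)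
  have proj: "continuous_map P (discrete_topology UNIV) (\<lambda>f. f a)" for a
    unfolding P_def by (rule continuous_map_product_projection) simp
  have opP: "openin P {f. f a = v}" for a v
    using openin_continuous_map_preimage[OF proj[of a], of "{v}"] by (simp add: topP)
  have opP2: "openin P {f. f a}" "openin P {f. \<not> f a}" for a
    using opP[of a True] opP[of a False] by simp_all
  have "closedin P D"
  proof -
    have "openin P ((\<Union>a\<in>-A. {f. f a}) \<union> (\<Union>(a, b)\<in>{(a, b). lt b a}. {f. f a} \<inter> {f. \<not> f b}))"
      using opP2 by (intro openin_Un openin_Union) auto
    moreover have "(\<Union>a\<in>-A. {f. f a}) \<union> (\<Union>(a, b)\<in>{(a, b). lt b a}. {f. f a} \<inter> {f. \<not> f b}) = - D"
      by (auto simp: D_def)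
    ultimately show ?thesis by (simp add: closedin_def topP Compl_eq_Diff_UNIV)
  qed
  then have K: "compact_space K" "Hausdorff_space K"
    using P by (auto simp: K_def compact_space_subtopology closedin_compact_space
        Hausdorff_space_subtopology)
  have xD: "x \<in> D" using down by (auto simp: x_def D_def)
  \<comment> \<open>Every other member of \<open>D\<close> is the initial segment below the least point that it omits.\<close>
  have ex: "\<exists>a. a \<in> A \<and> f = (\<lambda>b. lt b a)" if f: "f \<in> D" "f \<noteq> x" for f
  proof -
    have "\<exists>a. a \<in> A \<and> \<not> f a" using f by (auto simp: D_def x_def fun_eq_iff)
    then obtain a where a: "a \<in> A" "\<not> f a" and min: "\<And>b. lt b a \<Longrightarrow> \<not> (b \<in> A \<and> \<not> f b)"
      using wf[unfolded wfp_iff_ex_minimal, rule_format, of "{a. a \<in> A \<and> \<not> f a}"] by blast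
    have "f b \<longleftrightarrow> lt b a" for b
    proof
      assume "f b"
      then have "\<not> lt a b" "a \<noteq> b" using f(1) a(2) by (auto simp: D_def)
      then show "lt b a" using total by blast
    next
      assume "lt b a"
      then show "f b" using min down a(1) by blast
    qed
    then show ?thesis using a(1) by blast
  qed
  define g where "g f = (SOME a. a \<in> A \<and> f = (\<lambda>b. lt b a))" for f
  have g: "g f \<in> A" "f = (\<lambda>b. lt b (g f))" if "f \<in> D" "f \<noteq> x" for f
    using someI_ex[OF ex[OF that]] unfolding g_def by blast+
  define e where "e f = (if f = x then 0 else exp (g f))" for f
  have "inj_on e D"
  proof (rule inj_onI)
    fix f h assume "f \<in> D" "h \<in> D" "e f = e h"
    then show "f = h"
      using g[of f] g[of h] by (auto simp: e_def split: if_splits)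
  qed
  moreover have "e f \<noteq> - 1" for f
    using exp_gt_zero[of "g f"] unfolding e_def by (smt (verit))
  then have "- 1 \<notin> e ` D" by (metis imageE)
  moreover have "\<not> limitin K s x sequentially" if s: "range s \<subseteq> D - {x}" for s :: "nat \<Rightarrow> _"
  proof
    assume lim: "limitin K s x sequentially"
    have sn: "s n \<in> D" "s n \<noteq> x" for n using s by auto
    have "countable (\<Union>n. {b. lt b (g (s n))})" using g(1)[OF sn] seg by blast
    then obtain a where a: "a \<in> A" "a \<notin> (\<Union>n. {b. lt b (g (s n))})"
      using unc by (meson countable_subset subsetI)
    have "openin K (D \<inter> {f. f a})"
      unfolding K_def openin_subtopology using opP2(1) by blast
    moreover have "x \<in> D \<inter> {f. f a}" using xD a(1) by (simp add: x_def)
    ultimately have "\<forall>\<^sub>F n in sequentially. s n \<in> D \<inter> {f. f a}"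
      using lim by (auto simp: limitin_def)
    then obtain n where "s n a" by (auto simp: eventually_sequentially)
    then have "lt a (g (s n))" using g(2)[OF sn] by metis
    then show False using a(2) by blast
  qed
  moreover have "x \<in> K closure_of (D - {x})"
    unfolding in_closure_of
  proof (intro conjI allI impI)
    show "x \<in> topspace K" using xD by (simp add: topK)
    fix W assume "x \<in> W \<and> openin K W"
    then obtain V where V: "openin P V" "x \<in> V" "V \<inter> D \<subseteq> W"
      by (auto simp: K_def openin_subtopology)
    then obtain B where B: "finite {i. B i \<noteq> UNIV}" "x \<in> Pi\<^sub>E UNIV B" "Pi\<^sub>E UNIV B \<subseteq> V"
      unfolding P_def openin_product_topology_alt by force
    define F where "F = {i \<in> A. B i \<noteq> UNIV}"
    have F: "finite F" "F \<subseteq> A" using B(1) by (auto simp: F_def elim: finite_subset[rotated])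
    have "countable (\<Union>i\<in>F. insert i {b. lt b i})"
      using F seg by (intro countable_UN countable_insert) (auto intro: countable_finite)
    then obtain a where a: "a \<in> A" "a \<notin> (\<Union>i\<in>F. insert i {b. lt b i})"
      using unc by (meson countable_subset subsetI)
    \<comment> \<open>The point \<open>a\<close> lies above all the finitely many constrained coordinates in \<open>A\<close>.\<close>
    define f where "f b \<longleftrightarrow> lt b a" for b
    have irrefl: "\<not> lt a a" using wf by (metis wfp_imp_irreflp irreflpD)
    have "f \<in> D"
      using down a(1) trans by (auto simp: D_def f_def transp_def)
    moreover have "f \<noteq> x" using irrefl a(1) by (auto simp: f_def x_def fun_eq_iff)
    moreover have "f \<in> V"
    proof -
      have "f i \<in> B i" for i
      proof (cases "B i = UNIV")
        case False
        show ?thesis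
        proof (cases "i \<in> A")
          case True
          then have "f i" using False a(2) total[of i a] by (auto simp: F_def f_def)
          then show ?thesis using B(2) True by (auto simp: x_def PiE_iff dest: spec[of _ i])
        next
          case iA: False
          then have "\<not> f i" using down a(1) by (auto simp: f_def)
          then show ?thesis using B(2) iA by (auto simp: x_def PiE_iff dest: spec[of _ i])
        qed
      qed simp
      then show ?thesis using B(3) by auto
    qed
    ultimately show "\<exists>y. y \<in> D - {x} \<and> y \<in> W" using V(3) by blast
  qed
  ultimately show thesis using that[of K x e] K topK by simp
qed


section \<open>The strict chain\<close>

theorem corollary30:
  fixes X :: "'a topology"
  shows "(Hausdorff_space X \<longrightarrow> k1_Hausdorff_space X) \<and>
         (k1_Hausdorff_space X \<longrightarrow> kc_space X) \<and>
         (kc_space X \<longrightarrow> weakly_Hausdorff_space X) \<and>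
         (weakly_Hausdorff_space X \<longrightarrow> k2_Hausdorff_space X) \<and>
         (k2_Hausdorff_space X \<longrightarrow> US_space X) \<and>
         (US_space X \<longrightarrow> t1_space X) \<and>
         (\<exists>Y :: real topology. k1_Hausdorff_space Y \<and> \<not> Hausdorff_space Y) \<and>
         (\<exists>Y :: real topology. kc_space Y \<and> \<not> k1_Hausdorff_space Y) \<and>
         (\<exists>Y :: real topology. weakly_Hausdorff_space Y \<and> \<not> kc_space Y) \<and>
         (\<exists>Y :: real topology. k2_Hausdorff_space Y \<and> \<not> weakly_Hausdorff_space Y) \<and>
         (\<exists>Y :: real topology. US_space Y \<and> \<not> k2_Hausdorff_space Y) \<and>
         (\<exists>Y :: real topology. t1_space Y \<and> \<not> US_space Y)"
proof (intro conjI)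
  show "\<exists>Y :: real topology. k1_Hausdorff_space Y \<and> \<not> Hausdorff_space Y"
    using k1_Hausdorff_space_cocountable_topology
      not_Hausdorff_space_cocountable_topology[OF uncountable_UNIV_real] by blast
next
  obtain Y :: "real topology" where Y: "compactified_Rats homeomorphic_space Y"
    using countable_space_homeomorphic_real[OF countable_topspace_compactified_Rats] .
  have "kc_space Y" "compact_space Y" "\<not> Hausdorff_space Y"
    using Y kc_space_compactified_Rats compact_space_compactified_Rats
      not_Hausdorff_space_compactified_Rats homeomorphic_kc_space homeomorphic_compact_space
      homeomorphic_Hausdorff_space by blast+
  then have "\<not> k1_Hausdorff_space Y"
    by (metis compact_space_def k1_Hausdorff_space_def subtopology_topspace)
  then show "\<exists>Y :: real topology. kc_space Y \<and> \<not> k1_Hausdorff_space Y"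
    using \<open>kc_space Y\<close> by blast
next
  let ?Z = "prod_topology compactified_Rats compactified_Rats"
  obtain Y :: "real topology" where Y: "?Z homeomorphic_space Y"
    using countable_space_homeomorphic_real[of ?Z] countable_topspace_compactified_Rats
    by (metis countable_SIGMA topspace_prod_topology)
  have "weakly_Hausdorff_space Y"
    using Y kc_space_compactified_Rats
    by (meson homeomorphic_weakly_Hausdorff_space kc_imp_weakly_Hausdorff_space
        weakly_Hausdorff_space_prod_topology)
  moreover have "\<not> kc_space Y"
    using Y not_kc_space_square[OF compact_space_compactified_Rats
        not_Hausdorff_space_compactified_Rats] homeomorphic_kc_space by blast
  ultimately show "\<exists>Y :: real topology. weakly_Hausdorff_space Y \<and> \<not> kc_space Y" by blast
next
  have "uncountable {0::real..1}" by (simp add: uncountable_closed_interval)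
  moreover have "{0::real..1} \<noteq> UNIV" by (metis UNIV_I atLeastAtMost_iff not_one_le_zero zero_neq_neg_one
      neg_0_le_iff_le)
  ultimately have "\<not> weakly_Hausdorff_space (cocountable_compactification (0::real))"
    by (rule not_weakly_Hausdorff_space_cocountable_compactification) simp
  then show "\<exists>Y :: real topology. k2_Hausdorff_space Y \<and> \<not> weakly_Hausdorff_space Y"
    by (intro exI conjI) (rule k2_Hausdorff_space_cocountable_compactification)
next
  obtain K :: "(real \<Rightarrow> bool) topology" and x and e :: "(real \<Rightarrow> bool) \<Rightarrow> real"
    where K: "compact_space K" "Hausdorff_space K" "x \<in> K closure_of (topspace K - {x})"
      "\<And>s :: nat \<Rightarrow> _. range s \<subseteq> topspace K - {x} \<Longrightarrow> \<not> limitin K s x sequentially"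
      "inj_on e (topspace K)" "- 1 \<notin> e ` topspace K"
    by (rule ex_compact_Hausdorff_sequentially_isolated_point) blast
  show "\<exists>Y :: real topology. US_space Y \<and> \<not> k2_Hausdorff_space Y"
    by (rule ex_US_not_k2_Hausdorff_by_doubling[OF K])
next
  show "\<exists>Y :: real topology. t1_space Y \<and> \<not> US_space Y"
    using t1_space_cofinite_topology not_US_space_cofinite_topology[OF infinite_UNIV_char_0] by blast
qed (blast intro: Hausdorff_imp_k1_Hausdorff_space k1_Hausdorff_imp_kc_space
    kc_imp_weakly_Hausdorff_space weakly_Hausdorff_imp_k2_Hausdorff_space
    k2_Hausdorff_imp_US_space US_imp_t1_space)+

end
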